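(* Let $p\ge 2$ and let $\mathcal{S}=\{S_1,\ldots,S_p\}$ with $S_i\subseteq\mathbb{N}$ nonempty for $1\le i\le p$. The $\mathcal{S}$-limited shift $X(\mathcal{S})$ is a subshift of finite type if and only if every $S_i\in\mathcal{S}$ is finite or cofinite (in $\mathbb{N}$).
   Context: $\mathbb{N}=\{1,2,3,\ldots\}$. The alphabet is $\mathcal{A}=\{1,\ldots,p\}$, and $\mathcal{S}=\{S_1,\ldots,S_p\}$ is an indexed family (repetitions allowed). The core set is $G_{\mathcal{S}}=\{1^{m_1}2^{m_2}\cdots p^{m_p} : m_i\in S_i \text{ for } 1\le i\le p\}$, where $a^m$ is the letter $a$ repeated $m$ times. The $\mathcal{S}$-limited shift is the subshift $X(\mathcal{S})\subseteq\mathcal{A}^{\mathbb{Z}}$ given by the closure (in the product topology) of the set of all bi-infinite concatenations $\cdots x_{-1}x_0x_1\cdots$ with $x_i\in G_{\mathcal{S}}$ for all $i\in\mathbb{Z}$ (with the origin placed at any coordinate, so the set is shift-invariant). A subshift of $\mathcal{A}^{\mathbb{Z}}$ is a subshift of finite type (SFT) if it is the set of all points of $\mathcal{A}^{\mathbb{Z}}$ in which no word of some finite set $F$ of finite words (the forbidden words) appears. *)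

theory Defs
  imports "HOL-Analysis.Analysis"
begin

definition full_shift_top :: "nat \<Rightarrow> (int \<Rightarrow> nat) topology" where
  "full_shift_top p = product_topology (\<lambda>_. discrete_topology {1..p}) UNIV"

definition full_shift :: "nat \<Rightarrow> (int \<Rightarrow> nat) set" where
  "full_shift p = {x. \<forall>i. x i \<in> {1..p}}"

lemma topspace_full_shift_top: "topspace (full_shift_top p) = full_shift p"
  by (auto simp: full_shift_top_def full_shift_def)

text \<open>\<open>occurs_at w x k\<close>: the word \<open>w\<close> is read in \<open>x\<close> at the coordinates
  \<open>k, \<dots>, k + length w - 1\<close>.\<close>

definition occurs_at :: "nat list \<Rightarrow> (int \<Rightarrow> nat) \<Rightarrow> int \<Rightarrow> bool" where
  "occurs_at w x k \<longleftrightarrow> (\<forall>j<length w. x (k + int j) = w ! j)"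

definition is_SFT :: "nat \<Rightarrow> (int \<Rightarrow> nat) set \<Rightarrow> bool" where
  "is_SFT p X \<longleftrightarrow>
     (\<exists>F. finite F \<and> F \<subseteq> lists {1..p} \<and>
          X = {x \<in> full_shift p. \<forall>w\<in>F. \<not> (\<exists>k. occurs_at w x k)})"

text \<open>The words \<open>1^(m 1) 2^(m 2) \<dots> p^(m p)\<close> with \<open>m i \<in> S i\<close>.  Only the values
  \<open>S 1, \<dots>, S p\<close> of the family matter.\<close>

definition core_set :: "nat \<Rightarrow> (nat \<Rightarrow> nat set) \<Rightarrow> nat list set" where
  "core_set p S =
     {concat (map (\<lambda>i. replicate (m i) i) [1..<Suc p]) | m. \<forall>i\<in>{1..p}. m i \<in> S i}"

text \<open>\<open>w n\<close> is the \<open>n\<close>-th block and \<open>c n\<close> the coordinate at which it starts; leaving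
  \<open>c 0\<close> free places the origin at an arbitrary coordinate.  For a set \<open>G\<close> of nonempty
  words (as is \<open>core_set p S\<close> when all \<open>S i\<close> consist of positive integers) \<open>c\<close> is strictly
  increasing, so the blocks tile all of the integers and determine \<open>x\<close>.\<close>

definition bi_concats :: "nat list set \<Rightarrow> (int \<Rightarrow> nat) set" where
  "bi_concats G =
     {x. \<exists>(w :: int \<Rightarrow> nat list) (c :: int \<Rightarrow> int).
           \<forall>n. w n \<in> G \<and> c (n + 1) = c n + int (length (w n)) \<and> occurs_at (w n) x (c n)}"

definition limited_shift :: "nat \<Rightarrow> (nat \<Rightarrow> nat set) \<Rightarrow> (int \<Rightarrow> nat) set" where
  "limited_shift p S = full_shift_top p closure_of bi_concats (core_set p S)"

end

theory Submission
  imports Defs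
begin

text \<open>
  Every window of a point that obeys the four local rules of \<open>locally_ok\<close> (letters, transitions,
  lengths of partial runs, lengths of complete runs) extends to a bi-infinite concatenation: read
  the window from left to right and, whenever the next letter disagrees with the concatenation
  found so far, change the length of a single run and translate everything on both sides of it.
  Hence the limited shift consists of the points all of whose windows obey these rules, and it is
  an SFT if and only if windows of some fixed length suffice.  This is clear if every \<open>S i\<close> is
  finite or cofinite, since then only bounded lengths need to be told apart from larger ones;
  otherwise runs of a missing length longer than the window go undetected.
\<close>

section \<open>Windows\<close>

abbreviation agree_on :: "int \<Rightarrow> int \<Rightarrow> (int \<Rightarrow> nat) \<Rightarrow> (int \<Rightarrow> nat) \<Rightarrow> bool" where
  "agree_on a b x y \<equiv> \<forall>j\<in>{a..b}. x j = y j"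

text \<open>Basic open sets of the product topology constrain finitely many coordinates, and these
  lie in a common interval; so approximation by \<open>A\<close> amounts to agreement on every
  window.\<close>

lemma closure_of_full_shift_top:
  assumes "A \<subseteq> full_shift p"
  shows "x \<in> full_shift_top p closure_of A \<longleftrightarrow>
           x \<in> full_shift p \<and> (\<forall>a b. \<exists>y\<in>A. agree_on a b x y)"
proof (intro iffI conjI allI)
  assume x: "x \<in> full_shift_top p closure_of A"
  then show xf: "x \<in> full_shift p"
    by (simp add: in_closure_of topspace_full_shift_top)
  fix a b :: int
  \<comment> \<open>The cylinder that pins \<open>x\<close> on the window and leaves all other
    coordinates free.\<close>
  define U where "U = (\<lambda>i. if i \<in> {a..b} then {x i} else {1..p})"
  have "openin (full_shift_top p) (PiE UNIV U)"
    unfolding full_shift_top_def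
  proof (rule product_topology_basis)
    show "openin (discrete_topology {1..p}) (U i)" for i
      using xf by (auto simp: U_def full_shift_def)
    have "{i. U i \<noteq> topspace (discrete_topology {1..p})} \<subseteq> {a..b}"
      by (auto simp: U_def)
    then show "finite {i. U i \<noteq> topspace (discrete_topology {1..p})}"
      using finite_subset by blast
  qed
  moreover have "x \<in> PiE UNIV U"
    using xf by (auto simp: U_def full_shift_def)
  ultimately obtain y where "y \<in> A" "y \<in> PiE UNIV U"
    using x unfolding in_closure_of by blast
  then show "\<exists>y\<in>A. agree_on a b x y"
    by (intro bexI[of _ y]) (auto simp: U_def PiE_iff split: if_splits)
next
  assume *: "x \<in> full_shift p \<and> (\<forall>a b. \<exists>y\<in>A. agree_on a b x y)"
  show "x \<in> full_shift_top p closure_of A"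
    unfolding in_closure_of topspace_full_shift_top
  proof (intro conjI allI impI)
    show "x \<in> full_shift p" using * by simp
    fix T assume T: "x \<in> T \<and> openin (full_shift_top p) T"
    then obtain U where fin: "finite {i. U i \<noteq> {1..p}}" and xU: "x \<in> PiE UNIV U"
      and UT: "PiE UNIV U \<subseteq> T"
      unfolding full_shift_top_def openin_product_topology_alt by auto
    define J where "J = {i. U i \<noteq> {1..p}}"
    have "finite J" using fin by (simp add: J_def)
    then obtain a b where J: "J \<subseteq> {a..b}"
      using bdd_above_finite[of J] bdd_below_finite[of J]
      unfolding bdd_above_def bdd_below_def by (metis atLeastAtMost_iff subsetI)
    obtain y where y: "y \<in> A" "agree_on a b x y" using * by blast
    have "y i \<in> U i" for i
    proof (cases "i \<in> J")
      case True
      then show ?thesis using J y xU by (metis PiE_iff UNIV_I subsetD)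
    next
      case False
      then show ?thesis using y assms by (auto simp: J_def full_shift_def)
    qed
    then show "\<exists>y. y \<in> A \<and> y \<in> T" using y UT by blast
  qed
qed

text \<open>This removes forbidden words from the notion of SFT: a finite set of them matters only
  through a bound on the lengths, since all words of one fixed length that are absent from
  \<open>X\<close> can be forbidden instead.\<close>

lemma is_SFT_iff_window:
  assumes sub: "X \<subseteq> full_shift p"
    and shift: "\<And>x c. x \<in> X \<Longrightarrow> (\<lambda>j. x (j + c)) \<in> X"
  shows "is_SFT p X \<longleftrightarrow> (\<exists>N. \<forall>x\<in>full_shift p.
           (\<forall>k. \<exists>y\<in>X. agree_on k (k + int N) x y) \<longrightarrow> x \<in> X)"
proof
  assume "is_SFT p X"
  then obtain F where "finite F"
    and X: "X = {x \<in> full_shift p. \<forall>w\<in>F. \<not> (\<exists>k. occurs_at w x k)}"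
    unfolding is_SFT_def by blast
  obtain N where N: "\<And>w. w \<in> F \<Longrightarrow> length w \<le> N"
    using \<open>finite F\<close> by (metis finite_imageI finite_nat_set_iff_bounded_le imageI)
  have "x \<in> X" if x: "x \<in> full_shift p"
    and loc: "\<forall>k. \<exists>y\<in>X. agree_on k (k + int N) x y" for x
  proof -
    have "\<not> occurs_at w x k" if w: "w \<in> F" for w k
    proof
      assume "occurs_at w x k"
      moreover obtain y where y: "y \<in> X" "agree_on k (k + int N) x y" using loc by blast
      ultimately have "occurs_at w y k"
        using N[OF w] by (auto simp: occurs_at_def)
      then show False using y w X by blast
    qed
    then show ?thesis using x X by blast
  qed
  then show "\<exists>N. \<forall>x\<in>full_shift p. (\<forall>k. \<exists>y\<in>X. agree_on k (k + int N) x y) \<longrightarrow> x \<in> X"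
    by blast
next
  assume "\<exists>N. \<forall>x\<in>full_shift p. (\<forall>k. \<exists>y\<in>X. agree_on k (k + int N) x y) \<longrightarrow> x \<in> X"
  then obtain N where N: "\<And>x. x \<in> full_shift p \<Longrightarrow>
      (\<And>k. \<exists>y\<in>X. agree_on k (k + int N) x y) \<Longrightarrow> x \<in> X" by blast
  \<comment> \<open>\<open>Suc N\<close> is the number of letters in the window
    \<open>{k..k + int N}\<close>, and there are only finitely many words of this length.\<close>
  define F where "F = {w \<in> lists {1..p}. length w = Suc N \<and> (\<forall>y\<in>X. \<forall>k. \<not> occurs_at w y k)}"
  have "F \<subseteq> {w. set w \<subseteq> {1..p} \<and> length w = Suc N}" by (auto simp: F_def)
  then have "finite F" using finite_lists_length_eq finite_subset by blast
  moreover have "F \<subseteq> lists {1..p}" by (auto simp: F_def)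
  moreover have "X = {x \<in> full_shift p. \<forall>w\<in>F. \<not> (\<exists>k. occurs_at w x k)}"
  proof (intro subset_antisym subsetI)
    fix x assume "x \<in> X"
    then show "x \<in> {x \<in> full_shift p. \<forall>w\<in>F. \<not> (\<exists>k. occurs_at w x k)}"
      using sub by (auto simp: F_def)
  next
    fix x assume x: "x \<in> {x \<in> full_shift p. \<forall>w\<in>F. \<not> (\<exists>k. occurs_at w x k)}"
    show "x \<in> X"
    proof (rule N)
      show "x \<in> full_shift p" using x by simp
      fix k
      define w where "w = map (\<lambda>j. x (k + int j)) [0..<Suc N]"
      have len: "length w = Suc N" and nth: "\<And>j. j < Suc N \<Longrightarrow> w ! j = x (k + int j)"
        unfolding w_def by (simp_all del: upt_Suc)
      have "occurs_at w x k" using len nth by (simp add: occurs_at_def)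
      moreover have "w \<in> lists {1..p}" using x by (auto simp: w_def full_shift_def)
      \<comment> \<open>The word that \<open>x\<close> shows at \<open>k\<close> is not in
        \<open>F\<close>, so some \<open>y\<close> in \<open>X\<close> shows it at some
        \<open>l\<close>; shift invariance then moves this occurrence to \<open>k\<close>.\<close>
      ultimately obtain y l where y: "y \<in> X" "occurs_at w y l"
        using x len unfolding F_def by blast
      have "x j = y (j + (l - k))" if j: "j \<in> {k..k + int N}" for j
      proof -
        have i: "nat (j - k) < Suc N" "j = k + int (nat (j - k))" using j by auto
        then have "y (l + int (nat (j - k))) = x j"
          using y(2) nth[OF i(1)] len unfolding occurs_at_def by metis
        moreover have "l + int (nat (j - k)) = j + (l - k)" using j by simp
        ultimately show ?thesis by metis
      qed
      then show "\<exists>y\<in>X. agree_on k (k + int N) x y"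
        using shift[OF y(1), of "l - k"] by (intro bexI[of _ "\<lambda>j. y (j + (l - k))"]) auto
    qed
  qed
  ultimately show "is_SFT p X" unfolding is_SFT_def by blast
qed

section \<open>Run decompositions\<close>

text \<open>Residues start at 0 while letters start at 1, hence the \<open>Suc\<close>; for
  \<open>i\<close> in \<open>{1..p}\<close>, run \<open>int p * q + int i - 1\<close> is the one of
  letter \<open>i\<close> in core word number \<open>q\<close>.\<close>

definition letter :: "nat \<Rightarrow> int \<Rightarrow> nat" where
  "letter p n = Suc (nat (n mod int p))"

definition next_letter :: "nat \<Rightarrow> nat \<Rightarrow> nat" where
  "next_letter p i = (if i = p then 1 else Suc i)"

text \<open>Run number \<open>n\<close> is \<open>{d n..<d (n + 1)}\<close> and carries the letter \<open>letter p n\<close>, so that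
  \<open>p\<close> consecutive runs, starting at a multiple of \<open>p\<close>, make up one core word.\<close>

definition run_bounds :: "nat \<Rightarrow> (nat \<Rightarrow> nat set) \<Rightarrow> (int \<Rightarrow> int) \<Rightarrow> bool" where
  "run_bounds p S d \<longleftrightarrow> (\<forall>n. \<exists>m\<in>S (letter p n). d (n + 1) = d n + int m)"

definition painted :: "nat \<Rightarrow> (int \<Rightarrow> int) \<Rightarrow> (int \<Rightarrow> nat) \<Rightarrow> bool" where
  "painted p d x \<longleftrightarrow> (\<forall>n. \<forall>k\<in>{d n..<d (n + 1)}. x k = letter p n)"

lemma letter_in: "p > 0 \<Longrightarrow> letter p n \<in> {1..p}"
  by (simp add: letter_def Suc_le_eq nat_less_iff)

lemma letter_of_nat: "i \<in> {1..p} \<Longrightarrow> letter p (int p * n + int i - 1) = i"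
proof -
  assume i: "i \<in> {1..p}"
  have "(int p * n + int i - 1) mod int p = (int i - 1 + int p * n) mod int p"
    by (simp add: algebra_simps)
  also have "\<dots> = int i - 1" using i by (simp del: add_diff_eq)
  finally show ?thesis using i by (simp add: letter_def nat_diff_distrib Suc_le_eq)
qed

lemma letter_Suc: "p > 0 \<Longrightarrow> letter p (n + 1) = next_letter p (letter p n)"
proof -
  assume p: "p > 0"
  define i where "i = letter p n"
  have i: "i \<in> {1..p}" using letter_in[OF p] by (simp add: i_def)
  have n: "n = int p * (n div int p) + int i - 1"
    using p mult_div_mod_eq[of "int p" n] by (simp add: i_def letter_def)
  show ?thesis
  proof (cases "i = p")
    case True
    then have "n + 1 = int p * (n div int p + 1) + int 1 - 1" using n by (simp add: algebra_simps)
    then have "letter p (n + 1) = 1" using letter_of_nat[of 1 p "n div int p + 1"] p by simp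
    then show ?thesis using True by (simp add: next_letter_def i_def[symmetric])
  next
    case False
    then have "n + 1 = int p * (n div int p) + int (Suc i) - 1" using n by simp
    then have "letter p (n + 1) = Suc i"
      using letter_of_nat[of "Suc i" p "n div int p"] i False by simp
    then show ?thesis using False by (simp add: next_letter_def i_def[symmetric])
  qed
qed

section \<open>Strictly increasing integer sequences\<close>

lemma increasing_int_gap:
  fixes d :: "int \<Rightarrow> int"
  assumes "\<And>n. d n < d (n + 1)" "i \<le> j"
  shows "d i + (j - i) \<le> d j"
  using \<open>i \<le> j\<close>
proof (induction j rule: int_ge_induct)
  case (step j)
  then show ?case using assms(1)[of j] by simp
qed simp

text \<open>Otherwise \<open>d n \<le> k\<close> passes from each \<open>n\<close> to
  \<open>n + 1\<close>, so \<open>d\<close> never exceeds \<open>k\<close> from some index on, which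
  contradicts growth by at least one per step.\<close>

lemma increasing_int_cover:
  fixes d :: "int \<Rightarrow> int"
  assumes "\<And>n. d n < d (n + 1)"
  obtains n where "d n \<le> k" "k < d (n + 1)"
proof (rule ccontr)
  assume "\<not> thesis"
  with that have step: "\<And>n. d n \<le> k \<Longrightarrow> d (n + 1) \<le> k" by force
  \<comment> \<open>Going left from 0, \<open>d\<close> drops by at least one per step, so
    \<open>d m \<le> k\<close> holds at this index.\<close>
  define m where "m = min 0 (k - d 0)"
  have "d m \<le> k" using increasing_int_gap[of d m 0] assms by (auto simp: m_def)
  have all: "d n \<le> k" if "m \<le> n" for n
    using that \<open>d m \<le> k\<close> by (induction n rule: int_ge_induct) (auto intro: step)
  show False
    using all[of "m + (k - d m + 1)"] increasing_int_gap[of d m "m + (k - d m + 1)"] assms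
      \<open>d m \<le> k\<close> by simp
qed

lemma increasing_int_unique:
  fixes d :: "int \<Rightarrow> int"
  assumes "\<And>n. d n < d (n + 1)" "d n \<le> k" "k < d (n + 1)" "d m \<le> k" "k < d (m + 1)"
  shows "n = m"
  using increasing_int_gap[of d "n + 1" m] increasing_int_gap[of d "m + 1" n] assms by force

section \<open>Core words as sequences of runs\<close>

lemma occurs_at_append:
  "occurs_at (u @ v) x k \<longleftrightarrow> occurs_at u x k \<and> occurs_at v x (k + int (length u))"
proof -
  have "(\<forall>j<length u + length v. P j) \<longleftrightarrow>
      (\<forall>j<length u. P j) \<and> (\<forall>j<length v. P (length u + j))" for P
  proof (intro iffI conjI allI impI)
    fix j assume *: "(\<forall>j<length u. P j) \<and> (\<forall>j<length v. P (length u + j))" "j < length u + length v"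
    then show "P j" by (cases "j < length u") (auto dest: spec[of _ "j - length u"])
  qed auto
  from this[of "\<lambda>j. x (k + int j) = (u @ v) ! j"] show ?thesis
    by (simp add: occurs_at_def nth_append add.assoc)
qed

lemma occurs_at_replicate:
  "occurs_at (replicate m i) x k \<longleftrightarrow> (\<forall>j\<in>{k..<k + int m}. x j = i)"
proof -
  have "x j = i" if "\<forall>j<m. x (k + int j) = i" "j \<in> {k..<k + int m}" for j
    using that(1)[rule_format, of "nat (j - k)"] that(2) by auto
  then show ?thesis by (auto simp: occurs_at_def)
qed

lemma length_core_word:
  "length (concat (map (\<lambda>i. replicate (m i) i) [1..<q])) = sum m {1..<q}"
  by (simp add: length_concat comp_def interv_sum_list_conv_sum_set_nat)

text \<open>The partial sums of \<open>m\<close> are the offsets at which the blocks of the word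
  begin; in this form blocks become intervals of coordinates, as in \<open>painted\<close>.\<close>

lemma occurs_at_core_word:
  "occurs_at (concat (map (\<lambda>i. replicate (m i) i) [1..<Suc q])) x c \<longleftrightarrow>
     (\<forall>i\<in>{1..q}. \<forall>k\<in>{c + int (sum m {1..<i})..<c + int (sum m {1..<Suc i})}. x k = i)"
proof (induction q)
  case (Suc q)
  have ins: "{1..Suc q} = insert (Suc q) {1..q}" by auto
  have app: "concat (map (\<lambda>i. replicate (m i) i) [1..<Suc (Suc q)]) =
      concat (map (\<lambda>i. replicate (m i) i) [1..<Suc q]) @ replicate (m (Suc q)) (Suc q)"
    by simp
  have last: "c + int (sum m {1..<Suc q}) + int (m (Suc q)) = c + int (sum m {1..<Suc (Suc q)})"
    by simp
  show ?case
    unfolding app occurs_at_append occurs_at_replicate length_core_word Suc.IH ins ball_simps last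
    by blast
qed (simp add: occurs_at_def)


lemma letter_decomp:
  assumes "p > 0"
  obtains q i where "i \<in> {1..p}" "n = int p * q + int i - 1" "letter p n = i"
proof
  show "letter p n \<in> {1..p}" using letter_in[OF assms] .
  show "n = int p * (n div int p) + int (letter p n) - 1"
    using assms mult_div_mod_eq[of "int p" n] by (simp add: letter_def)
qed auto

text \<open>A core word is \<open>p\<close> consecutive runs: cutting every core word at its changes
  of letter gives \<open>d\<close>, and keeping every \<open>p\<close>-th entry of \<open>d\<close>
  gives back the starts of the core words.\<close>

lemma bi_concats_core_set_iff:
  assumes p: "p > 0"
  shows "x \<in> bi_concats (core_set p S) \<longleftrightarrow> (\<exists>d. run_bounds p S d \<and> painted p d x)"
proof
  assume "x \<in> bi_concats (core_set p S)"
  then obtain w :: "int \<Rightarrow> nat list" and c :: "int \<Rightarrow> int"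
    where w: "\<And>n. w n \<in> core_set p S"
    and c: "\<And>n. c (n + 1) = c n + int (length (w n))" and x: "\<And>n. occurs_at (w n) x (c n)"
    unfolding bi_concats_def by blast
  have "\<forall>n. \<exists>m. w n = concat (map (\<lambda>i. replicate (m i) i) [1..<Suc p]) \<and> (\<forall>i\<in>{1..p}. m i \<in> S i)"
    using w unfolding core_set_def by blast
  then obtain m where m: "\<And>n. w n = concat (map (\<lambda>i. replicate (m n i) i) [1..<Suc p])"
    "\<And>n i. i \<in> {1..p} \<Longrightarrow> m n i \<in> S i" by metis
  \<comment> \<open>Run \<open>n\<close> begins inside core word number \<open>n div int p\<close>,
    after the runs of all smaller letters.\<close>
  define d where "d n = c (n div int p) + int (sum (m (n div int p)) {1..<letter p n})" for n
  have d: "d (int p * q + int i - 1) = c q + int (sum (m q) {1..<i})" if i: "i \<in> {1..p}" for q i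
  proof -
    have "int p * q + int i - 1 = (int i - 1) + q * int p" by simp
    then have "(int p * q + int i - 1) div int p = (int i - 1 + q * int p) div int p" by metis
    also have "\<dots> = q" using i p by (subst div_mult_self1) auto
    finally show ?thesis unfolding d_def letter_of_nat[OF i] by simp
  qed
  have d_Suc: "d (int p * q + int i - 1 + 1) = c q + int (sum (m q) {1..<Suc i})"
    if i: "i \<in> {1..p}" for q i
  proof (cases "i = p")
    \<comment> \<open>The last run of a core word ends where the next core word begins.\<close>
    case True
    have "int p * q + int i - 1 + 1 = int p * (q + 1) + int 1 - 1"
      using True by (simp add: algebra_simps)
    then have "d (int p * q + int i - 1 + 1) = c (q + 1)" using d[of 1 "q + 1"] p by simp
    then show ?thesis using True c[of q] m(1)[of q] length_core_word[of "m q" "Suc p"] by simp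
  next
    case False
    then show ?thesis using d[of "Suc i" q] i by (simp add: algebra_simps)
  qed
  have "run_bounds p S d"
    unfolding run_bounds_def
  proof
    fix n
    obtain q i where i: "i \<in> {1..p}" "n = int p * q + int i - 1" "letter p n = i"
      using letter_decomp[OF p] by metis
    have "d (n + 1) = d n + int (m q i)"
      unfolding i(2) d[OF i(1)] d_Suc[OF i(1)] using i(1) by simp
    then show "\<exists>l\<in>S (letter p n). d (n + 1) = d n + int l" using m(2)[OF i(1)] i(3) by blast
  qed
  moreover have "painted p d x"
    unfolding painted_def
  proof
    fix n
    obtain q i where i: "i \<in> {1..p}" "n = int p * q + int i - 1" "letter p n = i"
      using letter_decomp[OF p] by metis
    show "\<forall>k\<in>{d n..<d (n + 1)}. x k = letter p n"
      using x[of q] i(1) unfolding m(1) occurs_at_core_word i(3) unfolding i(2) d[OF i(1)] d_Suc[OF i(1)]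
      by blast
  qed
  ultimately show "\<exists>d. run_bounds p S d \<and> painted p d x" by blast
next
  assume "\<exists>d. run_bounds p S d \<and> painted p d x"
  then obtain d where "run_bounds p S d" and x: "painted p d x" by blast
  then obtain m where m: "\<And>n. m n \<in> S (letter p n)" "\<And>n. d (n + 1) = d n + int (m n)"
    unfolding run_bounds_def by metis
  define M where "M q i = m (int p * q + int i - 1)" for q and i :: nat
  have M: "M q i \<in> S i" if "i \<in> {1..p}" for q i
    using m(1)[of "int p * q + int i - 1"] letter_of_nat[OF that] by (simp add: M_def)
  have sum: "d (int p * q) + int (sum (M q) {1..<Suc j}) = d (int p * q + int j)" for q j
  proof (induction j)
    case (Suc j)
    then show ?case using m(2)[of "int p * q + int j"] by (simp add: M_def algebra_simps)
  qed simp
  define w where "w q = concat (map (\<lambda>i. replicate (M q i) i) [1..<Suc p])" for q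
  have core: "w q \<in> core_set p S" for q unfolding w_def core_set_def using M by blast
  have step: "d (int p * (q + 1)) = d (int p * q) + int (length (w q))" for q
    unfolding w_def length_core_word sum by (simp add: algebra_simps)
  have occurs: "occurs_at (w q) x (d (int p * q))" for q
    unfolding w_def occurs_at_core_word
  proof
    fix i assume i: "i \<in> {1..p}"
    then obtain j where j: "i = Suc j" by (cases i) auto
    have "letter p (int p * q + int j) = i" using letter_of_nat[OF i, of q] j by simp
    moreover have "int p * q + int i = int p * q + int j + 1" using j by simp
    ultimately show "\<forall>k\<in>{d (int p * q) + int (sum (M q) {1..<i})..<
        d (int p * q) + int (sum (M q) {1..<Suc i})}. x k = i"
      using x unfolding painted_def sum j by (metis sum)
  qed
  show "x \<in> bi_concats (core_set p S)"
    unfolding bi_concats_def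
    by (intro CollectI exI[of _ w] exI[of _ "\<lambda>q. d (int p * q)"] allI conjI core step occurs)
qed

section \<open>Local characterization\<close>

text \<open>The third condition concerns runs that may continue beyond the window, the fourth one
  runs that the window shows completely.\<close>

definition locally_ok :: "nat \<Rightarrow> (nat \<Rightarrow> nat set) \<Rightarrow> int \<Rightarrow> int \<Rightarrow> (int \<Rightarrow> nat) \<Rightarrow> bool" where
  "locally_ok p S a b x \<longleftrightarrow>
     (\<forall>k\<in>{a..b}. x k \<in> {1..p}) \<and>
     (\<forall>k. a \<le> k \<and> k < b \<longrightarrow> x (k + 1) = x k \<or> x (k + 1) = next_letter p (x k)) \<and>
     (\<forall>k l. a \<le> k \<and> k \<le> l \<and> l \<le> b \<and> (\<forall>j\<in>{k..l}. x j = x k) \<longrightarrow>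
        (\<exists>m\<in>S (x k). l - k < int m)) \<and>
     (\<forall>k l. a < k \<and> k \<le> l \<and> l < b \<and> (\<forall>j\<in>{k..l}. x j = x k) \<and>
        x (k - 1) \<noteq> x k \<and> x (l + 1) \<noteq> x k \<longrightarrow> nat (l - k + 1) \<in> S (x k))"

lemma locally_okI:
  assumes "\<And>k. a \<le> k \<Longrightarrow> k \<le> b \<Longrightarrow> x k \<in> {1..p}"
    and "\<And>k. a \<le> k \<Longrightarrow> k < b \<Longrightarrow> x (k + 1) = x k \<or> x (k + 1) = next_letter p (x k)"
    and "\<And>k l. a \<le> k \<Longrightarrow> k \<le> l \<Longrightarrow> l \<le> b \<Longrightarrow> \<forall>j\<in>{k..l}. x j = x k \<Longrightarrow>
           \<exists>m\<in>S (x k). l - k < int m"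
    and "\<And>k l. a < k \<Longrightarrow> k \<le> l \<Longrightarrow> l < b \<Longrightarrow> \<forall>j\<in>{k..l}. x j = x k \<Longrightarrow>
           x (k - 1) \<noteq> x k \<Longrightarrow> x (l + 1) \<noteq> x k \<Longrightarrow> nat (l - k + 1) \<in> S (x k)"
  shows "locally_ok p S a b x"
  unfolding locally_ok_def
proof (intro conjI allI impI ballI)
  fix k assume "k \<in> {a..b}"
  then show "x k \<in> {1..p}" using assms(1) by simp
qed (elim conjE, rule assms(2-4); assumption)+

lemma
  assumes "locally_ok p S a b x"
  shows locally_ok_letter: "a \<le> k \<Longrightarrow> k \<le> b \<Longrightarrow> x k \<in> {1..p}"
    and locally_ok_step: "a \<le> k \<Longrightarrow> k < b \<Longrightarrow> x (k + 1) = x k \<or> x (k + 1) = next_letter p (x k)"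
    and locally_ok_run: "a \<le> k \<Longrightarrow> k \<le> l \<Longrightarrow> l \<le> b \<Longrightarrow> \<forall>j\<in>{k..l}. x j = x k \<Longrightarrow>
           \<exists>m\<in>S (x k). l - k < int m"
    and locally_ok_full_run: "a < k \<Longrightarrow> k \<le> l \<Longrightarrow> l < b \<Longrightarrow> \<forall>j\<in>{k..l}. x j = x k \<Longrightarrow>
           x (k - 1) \<noteq> x k \<Longrightarrow> x (l + 1) \<noteq> x k \<Longrightarrow> nat (l - k + 1) \<in> S (x k)"
proof -
  show "a \<le> k \<Longrightarrow> k \<le> b \<Longrightarrow> x k \<in> {1..p}"
    using assms[unfolded locally_ok_def, THEN conjunct1] by simp
  show "a \<le> k \<Longrightarrow> k < b \<Longrightarrow> x (k + 1) = x k \<or> x (k + 1) = next_letter p (x k)"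
    using assms[unfolded locally_ok_def, THEN conjunct2, THEN conjunct1] by blast
  show "a \<le> k \<Longrightarrow> k \<le> l \<Longrightarrow> l \<le> b \<Longrightarrow> \<forall>j\<in>{k..l}. x j = x k \<Longrightarrow>
      \<exists>m\<in>S (x k). l - k < int m"
    using assms[unfolded locally_ok_def, THEN conjunct2, THEN conjunct2, THEN conjunct1] by blast
  show "a < k \<Longrightarrow> k \<le> l \<Longrightarrow> l < b \<Longrightarrow> \<forall>j\<in>{k..l}. x j = x k \<Longrightarrow>
      x (k - 1) \<noteq> x k \<Longrightarrow> x (l + 1) \<noteq> x k \<Longrightarrow> nat (l - k + 1) \<in> S (x k)"
    using assms[unfolded locally_ok_def, THEN conjunct2, THEN conjunct2, THEN conjunct2] by blast
qed

lemma locally_ok_subset: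
  assumes x: "locally_ok p S a b x" and "a \<le> a'" "b' \<le> b"
  shows "locally_ok p S a' b' x"
proof (rule locally_okI)
  fix k assume "a' \<le> k" "k \<le> b'"
  then show "x k \<in> {1..p}" using assms(2,3) by (intro locally_ok_letter[OF x]) linarith+
next
  fix k assume "a' \<le> k" "k < b'"
  then show "x (k + 1) = x k \<or> x (k + 1) = next_letter p (x k)"
    using assms(2,3) by (intro locally_ok_step[OF x]) linarith+
next
  fix k l assume k: "a' \<le> k" "k \<le> l" "l \<le> b'" "\<forall>j\<in>{k..l}. x j = x k"
  show "\<exists>m\<in>S (x k). l - k < int m"
    by (rule locally_ok_run[OF x _ k(2) _ k(4)]) (use k(1,3) assms(2,3) in linarith)+
next
  fix k l assume k: "a' < k" "k \<le> l" "l < b'" "\<forall>j\<in>{k..l}. x j = x k"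
    "x (k - 1) \<noteq> x k" "x (l + 1) \<noteq> x k"
  show "nat (l - k + 1) \<in> S (x k)"
    by (rule locally_ok_full_run[OF x _ k(2) _ k(4-6)]) (use k(1,3) assms(2,3) in linarith)+
qed

lemma locally_ok_cong:
  assumes xy: "agree_on a b x y" and x: "locally_ok p S a b x"
  shows "locally_ok p S a b y"
proof (rule locally_okI)
  fix k assume "a \<le> k" "k \<le> b"
  then show "y k \<in> {1..p}" using xy locally_ok_letter[OF x, of k] by simp
next
  fix k assume "a \<le> k" "k < b"
  then show "y (k + 1) = y k \<or> y (k + 1) = next_letter p (y k)"
    using xy locally_ok_step[OF x, of k] by simp
next
  fix k l assume k: "a \<le> k" "k \<le> l" "l \<le> b" and y: "\<forall>j\<in>{k..l}. y j = y k"
  have "\<forall>j\<in>{k..l}. x j = y j" using xy k by simp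
  then have "\<forall>j\<in>{k..l}. x j = x k" "x k = y k" using y k(2) by (metis atLeastAtMost_iff order_refl)+
  then show "\<exists>m\<in>S (y k). l - k < int m" using locally_ok_run[OF x k] by metis
next
  fix k l assume k: "a < k" "k \<le> l" "l < b" and y: "\<forall>j\<in>{k..l}. y j = y k"
    and ne: "y (k - 1) \<noteq> y k" "y (l + 1) \<noteq> y k"
  have "\<forall>j\<in>{k..l}. x j = y j" using xy k by simp
  then have *: "\<forall>j\<in>{k..l}. x j = x k" "x k = y k" using y k(2) by (metis atLeastAtMost_iff order_refl)+
  have "x (k - 1) = y (k - 1)" "x (l + 1) = y (l + 1)" using xy k by simp_all
  then show "nat (l - k + 1) \<in> S (y k)" using locally_ok_full_run[OF x k] * ne by metis
qed

section \<open>Points built from run boundaries\<close>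

locale core_family =
  fixes p :: nat and S :: "nat \<Rightarrow> nat set"
  assumes two_letters: "p \<ge> 2"
    and lengths: "\<And>i. i \<in> {1..p} \<Longrightarrow> S i \<noteq> {} \<and> S i \<subseteq> {1..}"
begin

lemma letter_in': "letter p n \<in> {1..p}"
  using letter_in two_letters by simp

lemma letter_Suc_neq: "letter p (n + 1) \<noteq> letter p n"
  using letter_Suc[of p n] two_letters by (simp add: next_letter_def)

lemma run_bounds_less: "run_bounds p S d \<Longrightarrow> d n < d (n + 1)"
  unfolding run_bounds_def using lengths[OF letter_in'[of n]] by force

text \<open>Strictly increasing boundaries put every coordinate into exactly one run, whose letter
  can be written there.\<close>

lemma painted_exists:
  assumes "run_bounds p S d"
  shows "\<exists>x. painted p d x"
proof
  define block where "block k = (SOME n. d n \<le> k \<and> k < d (n + 1))" for k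
  have "block k = n" if "d n \<le> k" "k < d (n + 1)" for n k
  proof -
    have "d (block k) \<le> k \<and> k < d (block k + 1)"
      unfolding block_def using that by (intro someI) auto
    then show ?thesis
      using increasing_int_unique[of d] run_bounds_less[OF assms] that by blast
  qed
  then show "painted p d (\<lambda>k. letter p (block k))" by (auto simp: painted_def)
qed

text \<open>Any choice of admissible lengths can be summed up from a base point in both directions;
  prescribing \<open>d n = a\<close> lets a run of a given letter start at a given
  coordinate.\<close>

lemma run_bounds_exists:
  obtains d where "run_bounds p S d" "d n = a"
proof -
  have "\<forall>j. \<exists>l. l \<in> S (letter p j)" using lengths[OF letter_in'] by blast
  then obtain m where m: "\<And>j. m j \<in> S (letter p j)" by metis
  define d where "d j = (if n \<le> j then a + (\<Sum>i\<in>{n..<j}. int (m i))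
    else a - (\<Sum>i\<in>{j..<n}. int (m i)))" for j
  have "d (j + 1) = d j + int (m j)" for j
  proof (cases "n \<le> j")
    case True
    then have "{n..<j + 1} = insert j {n..<j}" by auto
    then show ?thesis using True by (simp add: d_def)
  next
    case False
    then have "{j..<n} = insert j {j + 1..<n}" by auto
    then show ?thesis using False by (auto simp: d_def)
  qed
  then have "run_bounds p S d" unfolding run_bounds_def using m by blast
  moreover have "d n = a" by (simp add: d_def)
  ultimately show ?thesis using that by blast
qed

text \<open>As \<open>p \<ge> 2\<close>, neighbouring runs carry different letters. Hence a constant
  stretch stays within one run, and it is the whole run if the letters on both sides differ from
  it.\<close>

lemma painted_locally_ok:
  assumes d: "run_bounds p S d" and x: "painted p d x"
  shows "locally_ok p S a b x"
proof -
  note less = run_bounds_less[OF d]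
  have val: "x k = letter p n" if "d n \<le> k" "k < d (n + 1)" for n k
    using x that by (auto simp: painted_def)
  have next_val: "x (d (n + 1)) = letter p (n + 1)" for n
    using val[of "n + 1" "d (n + 1)"] less[of "n + 1"] by simp
  have prev_val: "x (d n - 1) \<noteq> letter p n" for n
    using val[of "n - 1" "d n - 1"] less[of "n - 1"] letter_Suc_neq[of "n - 1"] by simp
  have same_run: "l < d (n + 1)" if "d n \<le> k" "k < d (n + 1)" "\<forall>j\<in>{k..l}. x j = x k" for n k l
  proof (rule ccontr)
    assume "\<not> l < d (n + 1)"
    then have "d (n + 1) \<in> {k..l}" using that by simp
    then show False using that next_val[of n] val[OF that(1,2)] letter_Suc_neq[of n] by metis
  qed
  show ?thesis
  proof (rule locally_okI)
    fix k
    obtain n where n: "d n \<le> k" "k < d (n + 1)" using increasing_int_cover[of d] less by metis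
    then show "x k \<in> {1..p}" using val letter_in' by metis
    show "x (k + 1) = x k \<or> x (k + 1) = next_letter p (x k)"
    proof (cases "k + 1 < d (n + 1)")
      case True
      then show ?thesis using val[of n] n by simp
    next
      case False
      then have "k + 1 = d (n + 1)" using n by simp
      then show ?thesis using next_val[of n] val[OF n] letter_Suc[of p n] two_letters by simp
    qed
  next
    fix k l assume k: "a \<le> k" "k \<le> l" "l \<le> b" "\<forall>j\<in>{k..l}. x j = x k"
    obtain n where n: "d n \<le> k" "k < d (n + 1)" using increasing_int_cover[of d] less by metis
    have "l < d (n + 1)" using same_run[OF n] k by blast
    moreover obtain m where "m \<in> S (letter p n)" "d (n + 1) = d n + int m"
      using d unfolding run_bounds_def by blast
    ultimately show "\<exists>m\<in>S (x k). l - k < int m"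
      using n val[OF n] by (intro bexI[of _ m]) auto
  next
    fix k l assume k: "a < k" "k \<le> l" "l < b" "\<forall>j\<in>{k..l}. x j = x k"
      "x (k - 1) \<noteq> x k" "x (l + 1) \<noteq> x k"
    obtain n where n: "d n \<le> k" "k < d (n + 1)" using increasing_int_cover[of d] less by metis
    have "l < d (n + 1)" using same_run[OF n] k by blast
    moreover obtain m where m: "m \<in> S (letter p n)" "d (n + 1) = d n + int m"
      using d unfolding run_bounds_def by blast
    \<comment> \<open>The differing neighbours force \<open>k = d n\<close> and
      \<open>l + 1 = d (n + 1)\<close>.\<close>
    moreover have "\<not> d n \<le> k - 1" using k(5) n val[of n "k - 1"] val[OF n] by force
    moreover have "\<not> l + 1 < d (n + 1)" using k(2,6) n val[of n "l + 1"] val[OF n] by force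
    ultimately have "l - k + 1 = int m" using n by linarith
    then show "nat (l - k + 1) \<in> S (x k)" using m val[OF n] by simp
  qed
qed

section \<open>Extending a window letter by letter\<close>

text \<open>\<open>run_bounds\<close> constrains only the differences of \<open>d\<close>, so run
  \<open>n\<close> may get any start \<open>s\<close> and any admissible length \<open>m\<close> if
  the runs before and after it are translated. With \<open>s = d n\<close> nothing before run
  \<open>n\<close> moves.\<close>

lemma replace_run:
  assumes d: "run_bounds p S d" and y: "painted p d y" and m: "m \<in> S (letter p n)"
  obtains d' y' where "run_bounds p S d'" "painted p d' y'"
    "\<And>k. s = d n \<Longrightarrow> k < s \<Longrightarrow> y' k = y k"
    "\<And>k. s \<le> k \<Longrightarrow> k < s + int m \<Longrightarrow> y' k = letter p n"
    "y' (s + int m) = letter p (n + 1)"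
proof -
  define d' where "d' j = (if j \<le> n then d j + (s - d n) else d j + (s + int m - d (n + 1)))" for j
  have d': "run_bounds p S d'"
    unfolding run_bounds_def
  proof
    fix j
    obtain l where l: "l \<in> S (letter p j)" "d (j + 1) = d j + int l"
      using d unfolding run_bounds_def by blast
    show "\<exists>l\<in>S (letter p j). d' (j + 1) = d' j + int l"
    proof (cases "j = n")
      case True
      then show ?thesis using m by (intro bexI[of _ m]) (auto simp: d'_def)
    next
      case False
      then show ?thesis using l by (intro bexI[of _ l]) (auto simp: d'_def)
    qed
  qed
  then obtain y' where y': "painted p d' y'" using painted_exists by blast
  have val: "y' k = letter p j" if "d' j \<le> k" "k < d' (j + 1)" for j k
    using y' that by (auto simp: painted_def)
  show ?thesis
  proof (rule that[OF d' y'])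
    fix k assume k: "s = d n" "k < s"
    obtain j where j: "d j \<le> k" "k < d (j + 1)"
      using increasing_int_cover[of d] run_bounds_less[OF d] by metis
    have "j < n" using increasing_int_gap[of d n j] run_bounds_less[OF d] j k by force
    then have "y' k = letter p j" using j k by (intro val) (auto simp: d'_def)
    also have "\<dots> = y k" using y j by (auto simp: painted_def)
    finally show "y' k = y k" .
  next
    fix k assume "s \<le> k" "k < s + int m"
    then show "y' k = letter p n" by (intro val) (auto simp: d'_def)
  next
    show "y' (s + int m) = letter p (n + 1)"
      using run_bounds_less[OF d, of "n + 1"] by (intro val) (auto simp: d'_def)
  qed
qed

text \<open>Induction on the right end: only the run that contains \<open>b\<close> has to be
  altered to give \<open>b + 1\<close> the right letter, and the rules of \<open>locally_ok\<close>
  supply an admissible length for it.\<close>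

lemma extend_window:
  assumes x: "locally_ok p S a b x" and "a \<le> b"
  shows "\<exists>d y. run_bounds p S d \<and> painted p d y \<and> agree_on a b x y"
  using \<open>a \<le> b\<close> x
proof (induction b rule: int_ge_induct)
  case base
  then have xa: "x a \<in> {1..p}" using locally_ok_letter by blast
  obtain d where d: "run_bounds p S d" "d (int (x a) - 1) = a" using run_bounds_exists .
  then obtain y where y: "painted p d y" using painted_exists by blast
  have "y a = letter p (int (x a) - 1)"
    using y d(2) run_bounds_less[OF d(1), of "int (x a) - 1"] by (auto simp: painted_def)
  also have "\<dots> = x a" using letter_of_nat[OF xa, of 0] by simp
  finally show ?case using d y by (intro exI[of _ d] exI[of _ y]) auto
next
  case (step b)
  note ok = locally_ok_step[OF step.prems]
  note run = locally_ok_run[OF step.prems]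
  note full = locally_ok_full_run[OF step.prems]
  obtain d y where d: "run_bounds p S d" and y: "painted p d y" and xy: "agree_on a b x y"
    using step.IH locally_ok_subset[OF step.prems, of a b] by auto
  obtain n where n: "d n \<le> b" "b < d (n + 1)"
    using increasing_int_cover[of d] run_bounds_less[OF d] by metis
  \<comment> \<open>The first coordinate of the window that lies in run \<open>n\<close>.\<close>
  define r where "r = max a (d n)"
  have r: "a \<le> r" "d n \<le> r" "r \<le> b" using n step.hyps by (auto simp: r_def)
  have x_run: "x j = letter p n" if "j \<in> {r..b}" for j
    using that xy y n r unfolding painted_def by auto
  \<comment> \<open>\<open>s\<close> and \<open>m\<close> are the new start and length of run
    \<open>n\<close>. Its start may move only if the window shows nothing before it; its end lies
    exactly before \<open>b + 1\<close> or beyond, as \<open>x (b + 1)\<close> demands.\<close>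
  obtain s m where m: "m \<in> S (letter p n)" and s: "s = d n \<or> s \<le> a \<and> d n \<le> a" "s \<le> r" "b < s + int m"
    and edge: "if x (b + 1) = letter p n then b + 1 < s + int m else b + 1 = s + int m"
  proof (cases "x (b + 1) = letter p n")
    case True
    have "x j = letter p n" if "j \<in> {r..b + 1}" for j
      using x_run[of j] True that by (cases "j = b + 1") auto
    then have const: "\<forall>j\<in>{r..b + 1}. x j = x r" using r by simp
    obtain m where "m \<in> S (x r)" "b + 1 - r < int m"
      using run[OF r(1) _ order_refl const] r(3) by auto
    then show ?thesis
      using that[of m r] True x_run[of r] r by (auto simp: r_def max_def)
  next
    case False
    have const: "\<forall>j\<in>{r..b}. x j = x r" using x_run r by simp
    show ?thesis
    proof (cases "d n \<le> a")
      case True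
      \<comment> \<open>What precedes the run is out of sight: any admissible \<open>m\<close>
        covering the visible part will do, with the start moved to \<open>b + 1 - int m\<close>,
        which is at most \<open>a\<close>.\<close>
      then have "r = a" by (simp add: r_def)
      then obtain m where "m \<in> S (letter p n)" "b - a < int m"
        using run[OF r(1,3) _ const] x_run[of r] r(3) by auto
      then show ?thesis using that[of m "b + 1 - int m"] False True r \<open>r = a\<close> by auto
    next
      case da: False
      \<comment> \<open>Now the window shows the run with both neighbours, so its length must be
        kept as it is in \<open>x\<close>, and the rule for complete runs makes it
        admissible.\<close>
      then have rd: "r = d n" by (simp add: r_def)
      have "x (r - 1) = y (r - 1)" using xy da rd r by auto
      also have "\<dots> = letter p (n - 1)"
        using y run_bounds_less[OF d, of "n - 1"] rd unfolding painted_def by auto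
      finally have "x (r - 1) \<noteq> x r" using letter_Suc_neq[of "n - 1"] x_run[of r] r by auto
      then have "nat (b - r + 1) \<in> S (x r)"
        using full[OF _ r(3) _ const] x_run[of r] r(3) rd da False by auto
      then show ?thesis using that[of "nat (b - r + 1)" r] x_run[of r] rd r False by auto
    qed
  qed
  obtain d' y' where d': "run_bounds p S d'" "painted p d' y'"
    and left: "\<And>k. s = d n \<Longrightarrow> k < s \<Longrightarrow> y' k = y k"
    and mid: "\<And>k. s \<le> k \<Longrightarrow> k < s + int m \<Longrightarrow> y' k = letter p n"
    and right: "y' (s + int m) = letter p (n + 1)"
    using replace_run[OF d y m, of s] by blast
  have "x j = y' j" if j: "j \<in> {a..b + 1}" for j
  proof (cases "j = b + 1")
    case True
    have "x b = letter p n" using x_run r by simp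
    then have "x (b + 1) = letter p n \<or> x (b + 1) = letter p (n + 1)"
      using ok[of b] step.hyps letter_Suc[of p n] two_letters by auto
    then show ?thesis using True edge mid[of "b + 1"] right s r by (auto split: if_splits)
  next
    case False
    show ?thesis
    proof (cases "s \<le> j")
      case True
      then have "j \<in> {r..b}" using j False s by (auto simp: r_def)
      then show ?thesis using x_run mid[of j] True s by auto
    next
      case sj: False
      then show ?thesis using left[of j] s xy j False by auto
    qed
  qed
  then show ?case using d' by blast
qed

lemma locally_ok_iff:
  "locally_ok p S a b x \<longleftrightarrow> (\<exists>y\<in>bi_concats (core_set p S). agree_on a b x y)"
proof -
  have concats: "y \<in> bi_concats (core_set p S) \<longleftrightarrow> (\<exists>d. run_bounds p S d \<and> painted p d y)" for y
    using bi_concats_core_set_iff two_letters by simp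
  show ?thesis
  proof
    assume "locally_ok p S a b x"
    then have "\<exists>d y. run_bounds p S d \<and> painted p d y \<and> agree_on a b x y"
    proof (cases "a \<le> b")
      \<comment> \<open>An empty window is matched by any concatenation, and one exists because the
        sets of lengths are nonempty.\<close>
      case False
      obtain d y where "run_bounds p S d" "painted p d y"
        using run_bounds_exists painted_exists by metis
      then show ?thesis using False by auto
    qed (rule extend_window)
    then show "\<exists>y\<in>bi_concats (core_set p S). agree_on a b x y" using concats by blast
  next
    assume "\<exists>y\<in>bi_concats (core_set p S). agree_on a b x y"
    then obtain d y where "run_bounds p S d" "painted p d y" "agree_on a b y x"
      using concats by (metis (full_types))
    then show "locally_ok p S a b x" using locally_ok_cong painted_locally_ok by blast
  qed
qed

text \<open>Windows of concatenations are exactly the locally correct ones, so the description of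
  the closure becomes local; one-letter windows already give membership in the full shift.\<close>

lemma limited_shift_iff: "x \<in> limited_shift p S \<longleftrightarrow> (\<forall>a b. locally_ok p S a b x)"
proof -
  have full: "y \<in> full_shift p" if "\<And>k. locally_ok p S k k y" for y
    using locally_ok_letter[OF that] by (simp add: full_shift_def)
  have "bi_concats (core_set p S) \<subseteq> full_shift p"
  proof
    fix y assume "y \<in> bi_concats (core_set p S)"
    then have "locally_ok p S k k y" for k unfolding locally_ok_iff by blast
    then show "y \<in> full_shift p" by (rule full)
  qed
  from closure_of_full_shift_top[OF this]
  have "x \<in> limited_shift p S \<longleftrightarrow> x \<in> full_shift p \<and> (\<forall>a b. locally_ok p S a b x)"
    unfolding limited_shift_def locally_ok_iff .
  then show ?thesis using full[of x] by metis
qed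

lemma bi_concats_shift:
  assumes "x \<in> bi_concats G"
  shows "(\<lambda>j. x (j + t)) \<in> bi_concats G"
proof -
  obtain w :: "int \<Rightarrow> nat list" and c :: "int \<Rightarrow> int" where
    "\<forall>n. w n \<in> G \<and> c (n + 1) = c n + int (length (w n)) \<and> occurs_at (w n) x (c n)"
    using assms unfolding bi_concats_def by blast
  then show ?thesis
    unfolding bi_concats_def occurs_at_def
    by (intro CollectI exI[of _ w] exI[of _ "\<lambda>n. c n - t"]) (simp add: algebra_simps)
qed

lemma limited_shift_shift:
  assumes "x \<in> limited_shift p S"
  shows "(\<lambda>j. x (j + t)) \<in> limited_shift p S"
  unfolding limited_shift_iff
proof (intro allI)
  fix a b
  obtain y where y: "y \<in> bi_concats (core_set p S)" "agree_on (a + t) (b + t) x y"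
    using assms unfolding limited_shift_iff locally_ok_iff by blast
  have "agree_on a b (\<lambda>j. x (j + t)) (\<lambda>j. y (j + t))" using y(2) by simp
  then show "locally_ok p S a b (\<lambda>j. x (j + t))"
    unfolding locally_ok_iff using bi_concats_shift[OF y(1), of t] by (rule bexI)
qed

text \<open>Every locally correct window occurs in a concatenation and thus in the limited shift, so
  the window criterion turns into a question about \<open>locally_ok\<close> alone.\<close>

lemma is_SFT_limited_shift_iff:
  "is_SFT p (limited_shift p S) \<longleftrightarrow>
     (\<exists>N. \<forall>x. (\<forall>k. locally_ok p S k (k + int N) x) \<longrightarrow> (\<forall>a b. locally_ok p S a b x))"
proof -
  have full: "x \<in> full_shift p" if "\<And>k. locally_ok p S k (k + int N) x" for x N
    unfolding full_shift_def using locally_ok_letter[OF that order_refl] by simp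
  have sub: "limited_shift p S \<subseteq> full_shift p"
    using full[of 0] by (auto simp: limited_shift_iff)
  have window: "(\<exists>y\<in>limited_shift p S. agree_on a b x y) \<longleftrightarrow> locally_ok p S a b x" for a b x
  proof
    assume "\<exists>y\<in>limited_shift p S. agree_on a b x y"
    then obtain y where y: "y \<in> limited_shift p S" "agree_on a b x y" by blast
    then have "agree_on a b y x" by simp
    then show "locally_ok p S a b x"
      using y(1) unfolding limited_shift_iff by (metis locally_ok_cong)
  next
    assume "locally_ok p S a b x"
    then obtain y where y: "y \<in> bi_concats (core_set p S)" "agree_on a b x y"
      unfolding locally_ok_iff by blast
    have "y \<in> limited_shift p S" unfolding limited_shift_iff locally_ok_iff using y(1) by blast
    then show "\<exists>y\<in>limited_shift p S. agree_on a b x y" using y(2) by blast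
  qed
  have "is_SFT p (limited_shift p S) \<longleftrightarrow> (\<exists>N. \<forall>x\<in>full_shift p.
      (\<forall>k. locally_ok p S k (k + int N) x) \<longrightarrow> x \<in> limited_shift p S)"
    using is_SFT_iff_window[OF sub limited_shift_shift] unfolding window .
  then show ?thesis unfolding limited_shift_iff using full by metis
qed

section \<open>Finite and cofinite sets of lengths\<close>

text \<open>Beyond a common bound \<open>B\<close> each set contains every length or none, so a run
  needs to be measured only up to \<open>B + 1\<close>.\<close>

lemma SFT_if_finite_or_cofinite:
  assumes "\<And>i. i \<in> {1..p} \<Longrightarrow> finite (S i) \<or> finite ({1..} - S i)"
  shows "is_SFT p (limited_shift p S)"
proof -
  have "\<forall>i\<in>{1..p}. \<exists>B. S i \<subseteq> {..B} \<or> {1..} - S i \<subseteq> {..B}"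
    using assms finite_nat_iff_bounded_le by blast
  then obtain f where f: "\<And>i. i \<in> {1..p} \<Longrightarrow> S i \<subseteq> {..f i} \<or> {1..} - S i \<subseteq> {..f i}"
    by metis
  define B where "B = sum f {1..p}"
  have B: "l \<in> S i" if "i \<in> {1..p}" "m \<in> S i" "B < m" "B < l" for i l m
  proof -
    have "f i \<le> B" unfolding B_def using that(1) by (intro member_le_sum) auto
    then have "m \<notin> {..f i}" "l \<notin> {..f i}" "l \<in> {1..}" using that by auto
    then show ?thesis using f[OF that(1)] that(2) by blast
  qed
  \<comment> \<open>These windows have \<open>B + 2\<close> letters, just enough for a complete run
    of length at most \<open>B\<close> with both neighbours.\<close>
  have "locally_ok p S a b x" if W: "\<And>k. locally_ok p S k (k + int (Suc B)) x" for a b x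
  proof -
    have letters: "x k \<in> {1..p}" for k using locally_ok_letter[OF W, of k k] by simp
    have run: "\<exists>m\<in>S (x k). l - k < int m" if kl: "k \<le> l" "\<forall>j\<in>{k..l}. x j = x k" for k l
    proof -
      \<comment> \<open>Cut to at most \<open>B + 1\<close> letters, the stretch fits into one
        window; if the cut is proper, the length found exceeds \<open>B\<close>, and then the length
        of the full stretch is itself admissible.\<close>
      define l' where "l' = min l (k + int B)"
      have l': "k \<le> l'" "l' \<le> l" "l' \<le> k + int (Suc B)" using kl(1) by (auto simp: l'_def)
      have "\<forall>j\<in>{k..l'}. x j = x k" using kl(2) l' by (meson atLeastAtMost_iff order_trans)
      then obtain m where m: "m \<in> S (x k)" "l' - k < int m"
        using locally_ok_run[OF W[of k] order_refl l'(1,3)] by blast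
      show ?thesis
      proof (cases "l' = l")
        case True
        then show ?thesis using m by blast
      next
        case False
        then have "B < m" "B < nat (l - k + 1)" using m(2) by (auto simp: l'_def min_def split: if_splits)
        then have "nat (l - k + 1) \<in> S (x k)" using B letters m(1) by blast
        then show ?thesis using kl(1) by (intro bexI[of _ "nat (l - k + 1)"]) auto
      qed
    qed
    show ?thesis
    proof (rule locally_okI)
      fix k show "x k \<in> {1..p}" by (rule letters)
      show "x (k + 1) = x k \<or> x (k + 1) = next_letter p (x k)"
        using locally_ok_step[OF W[of k], of k] by simp
    next
      fix k l assume "k \<le> l" "\<forall>j\<in>{k..l}. x j = x k"
      then show "\<exists>m\<in>S (x k). l - k < int m" by (rule run)
    next
      fix k l assume kl: "k \<le> l" "\<forall>j\<in>{k..l}. x j = x k" "x (k - 1) \<noteq> x k" "x (l + 1) \<noteq> x k"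
      show "nat (l - k + 1) \<in> S (x k)"
      proof (cases "l - k + 1 \<le> int B")
        case True
        then show ?thesis using locally_ok_full_run[OF W[of "k - 1"] _ kl(1) _ kl(2-4)] by simp
      next
        case False
        \<comment> \<open>Both \<open>m\<close> and the length of the run exceed
          \<open>B\<close>.\<close>
        obtain m where m: "m \<in> S (x k)" "l - k < int m" using run[OF kl(1,2)] by blast
        show ?thesis by (rule B[OF letters m(1)]) (use False m(2) in linarith)+
      qed
    qed
  qed
  then show ?thesis unfolding is_SFT_limited_shift_iff by blast
qed

text \<open>If \<open>S i\<close> is infinite, no partial run of \<open>i\<close> violates a rule;
  if its complement is infinite too, some forbidden length is too long for a given window to
  show.\<close>

lemma finite_or_cofinite_if_SFT:
  assumes "is_SFT p (limited_shift p S)" and i: "i \<in> {1..p}"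
  shows "finite (S i) \<or> finite ({1..} - S i)"
proof (rule ccontr)
  assume "\<not> ?thesis"
  then have inf: "infinite (S i)" "infinite ({1..} - S i)" by auto
  obtain N where N: "\<And>x a b. (\<And>k. locally_ok p S k (k + int N) x) \<Longrightarrow> locally_ok p S a b x"
    using assms(1) unfolding is_SFT_limited_shift_iff by blast
  obtain k where k: "k \<in> {1..} - S i" "N < k"
    using inf(2) unfolding infinite_nat_iff_unbounded by blast
  \<comment> \<open>All runs of \<open>i\<close> get the forbidden length \<open>k\<close>, and no window of length \<open>N\<close> shows one completely.\<close>
  define T where "T = S(i := {k})"
  \<comment> \<open>\<open>T\<close> again consists of nonempty sets of positive lengths, so points
    can be built from it, and they obey the rules for \<open>T\<close> in every window.\<close>
  interpret T: core_family p T
    using two_letters lengths k(1) by unfold_locales (auto simp: T_def)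
  define n where "n = int i - 1"
  have n: "letter p n = i" using letter_of_nat[OF i, of 0] by (simp add: n_def)
  obtain d where d: "run_bounds p T d" using T.run_bounds_exists by metis
  obtain x where x: "painted p d x" using T.painted_exists[OF d] by blast
  note ok = T.painted_locally_ok[OF d x]
  have "locally_ok p S t (t + int N) x" for t
  proof (rule locally_okI)
    fix s assume "t \<le> s" "s \<le> t + int N"
    then show "x s \<in> {1..p}" by (rule locally_ok_letter[OF ok])
  next
    fix s assume "t \<le> s" "s < t + int N"
    then show "x (s + 1) = x s \<or> x (s + 1) = next_letter p (x s)" by (rule locally_ok_step[OF ok])
  next
    fix s l assume sl: "t \<le> s" "s \<le> l" "l \<le> t + int N" "\<forall>j\<in>{s..l}. x j = x s"
    show "\<exists>m\<in>S (x s). l - s < int m"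
    proof (cases "x s = i")
      case True
      obtain m where "m \<in> S i" "nat (l - s) < m"
        using inf(1) unfolding infinite_nat_iff_unbounded by blast
      then show ?thesis using True by (intro bexI[of _ m]) auto
    next
      case False
      then show ?thesis using locally_ok_run[OF ok sl] by (simp add: T_def)
    qed
  next
    fix s l assume sl: "t < s" "s \<le> l" "l < t + int N" "\<forall>j\<in>{s..l}. x j = x s"
      "x (s - 1) \<noteq> x s" "x (l + 1) \<noteq> x s"
    have "nat (l - s + 1) \<in> T (x s)" by (rule locally_ok_full_run[OF ok sl])
    \<comment> \<open>A run strictly inside the window has at most \<open>N - 1\<close>
      letters.\<close>
    moreover have "nat (l - s + 1) \<noteq> k" using sl(1-3) k(2) by linarith
    ultimately show "nat (l - s + 1) \<in> S (x s)" by (auto simp: T_def split: if_splits)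
  qed
  then have all: "locally_ok p S a b x" for a b by (rule N)
  have len: "d (n + 1) = d n + int k"
    using d n unfolding run_bounds_def by (metis T_def fun_upd_same singletonD)
  have run: "x j = i" if "d n \<le> j" "j < d n + int k" for j
    using x that n len unfolding painted_def by (metis atLeastLessThan_iff)
  have kpos: "0 < k" using k by simp
  have "x (d n - 1) = letter p (n - 1)"
    using x T.run_bounds_less[OF d, of "n - 1"] unfolding painted_def by simp
  then have left: "x (d n - 1) \<noteq> x (d n)"
    using run[of "d n"] kpos letter_Suc_neq[of "n - 1"] n by simp
  have "x (d (n + 1)) = letter p (n + 1)"
    using x T.run_bounds_less[OF d, of "n + 1"] unfolding painted_def by simp
  then have right: "x (d n + int k - 1 + 1) \<noteq> x (d n)"
    using run[of "d n"] kpos letter_Suc_neq[of n] n len by simp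
  have const: "\<forall>j\<in>{d n..d n + int k - 1}. x j = x (d n)" using run kpos by simp
  \<comment> \<open>The window from \<open>d n - 1\<close> to \<open>d n + int k\<close> shows run
    \<open>n\<close> with both neighbours, and the rule for complete runs would put \<open>k\<close>
    into \<open>S i\<close>.\<close>
  have "nat (d n + int k - 1 - d n + 1) \<in> S (x (d n))"
    using kpos
    by (intro locally_ok_full_run[OF all[of "d n - 1" "d n + int k"] _ _ _ const left right]) auto
  then show False using k(1) run[of "d n"] kpos by simp
qed

end

theorem proposition3p1:
  fixes p :: nat and S :: "nat \<Rightarrow> nat set"
  assumes "p \<ge> 2"
    and "\<And>i. i \<in> {1..p} \<Longrightarrow> S i \<noteq> {} \<and> S i \<subseteq> {1..}"
  shows "is_SFT p (limited_shift p S) \<longleftrightarrow>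
           (\<forall>i\<in>{1..p}. finite (S i) \<or> finite ({1..} - S i))"
proof -
  interpret core_family p S using assms by unfold_locales
  show ?thesis by (metis SFT_if_finite_or_cofinite finite_or_cofinite_if_SFT)
qed

end
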